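(* Let $n$ be a positive integer, and let $C$ be a binary constant weight code of length $2n$ and weight $n$, i.e. $C\subseteq\binom{[2n]}{n}$. Let $S(C)=\{d_J(x,y): x,y\in C,\ x\neq y\}$ be its degree set and $s=|S(C)|$ its degree. Suppose that $n-a\in S(C)$ whenever $a\in S(C)$. Then $$|C|\le \binom{2n-1}{s}.$$
   Context: $[2n]=\{1,\ldots,2n\}$ and $\binom{[2n]}{n}$ is the set of all subsets of $[2n]$ of size $n$; a subset is identified with its characteristic $(0,1)$-vector of length $2n$. For $x,y\in\binom{[2n]}{n}$, $d_J(x,y)=n-|x\cap y|$ (half the Hamming distance of the characteristic vectors). *)

theory Defs
  imports Main
begin

text \<open>Codewords are given by their supports: subsets of \<open>{1..2*n}\<close> of size \<open>n\<close>.\<close>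

definition const_weight_words :: "nat \<Rightarrow> nat set set" where
  "const_weight_words n = {x. x \<subseteq> {1..2 * n} \<and> card x = n}"

text \<open>The truncated subtraction is exact on codewords, since then \<open>card (x \<inter> y) \<le> n\<close>.\<close>

definition johnson_dist :: "nat \<Rightarrow> nat set \<Rightarrow> nat set \<Rightarrow> nat" where
  "johnson_dist n x y = n - card (x \<inter> y)"

definition degree_set :: "nat \<Rightarrow> nat set set \<Rightarrow> nat set" where
  "degree_set n C = {johnson_dist n x y | x y. x \<in> C \<and> y \<in> C \<and> x \<noteq> y}"

end

theory Submission
  imports Defs Complex_Main "HOL-Library.Function_Algebras"
begin

text \<open>
  Replacing a codeword by its complement in \<open>{1..2 * n}\<close> changes its distance \<open>a\<close> to every other
  codeword into \<open>n - a\<close>, and the degree set is assumed to be closed under this reflection. It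
  does not contain \<open>0\<close>, so it does not contain \<open>n\<close> either: no two codewords are complementary.
  Hence every codeword that contains the point \<open>2 * n\<close> may be traded for its complement without
  merging codewords and without creating new distances. What results is a family of as many
  \<open>n\<close>-subsets of \<open>{1..2 * n - 1}\<close>. Two distinct members at distance \<open>a\<close> meet in \<open>n - a\<close> points, so
  all their intersection sizes lie in the degree set too. This is a uniform family with \<open>s\<close>
  intersection sizes on \<open>2 * n - 1\<close> points, and the Ray-Chaudhuri--Wilson theorem bounds it by
  \<open>(2 * n - 1) choose s\<close>.

  The Ray-Chaudhuri--Wilson theorem is proved by linear algebra. Let \<open>F\<close> be a family of
  \<open>k\<close>-subsets of \<open>V\<close> with intersection sizes in \<open>L\<close>, where \<open>k \<notin> L\<close> and \<open>card L \<le> k\<close>. To each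
  member \<open>x\<close> belongs the function \<open>z \<mapsto> \<Prod>l\<in>L. (card (x \<inter> z) - l)\<close> on the \<open>k\<close>-sets. On \<open>F\<close> it
  vanishes everywhere except at \<open>x\<close>, so these functions are linearly independent. It is a
  polynomial of degree \<open>card L\<close> in the coordinates of \<open>z\<close>. Since \<open>z\<close> has the constant size
  \<open>k \<ge> card L\<close>, every monomial of smaller degree is a combination of monomials of degree exactly
  \<open>card L\<close>; there are \<open>card V choose card L\<close> of these, and they span all the functions.
\<close>

section \<open>Functions on the sets of a fixed size\<close>

interpretation fun_vs: vector_space "\<lambda>(c::real) (f::'a \<Rightarrow> real) x. c * f x"
  by unfold_locales (auto simp: plus_fun_def algebra_simps)

lemma sum_fun_apply: "(\<Sum>i\<in>A. f i) x = (\<Sum>i\<in>A. f i x)" for f :: "'b \<Rightarrow> 'a \<Rightarrow> real"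
  by (induction A rule: infinite_finite_induct) auto

text \<open>
  The squarefree monomial with support \<open>T\<close>, read as a function on the \<open>k\<close>-subsets of \<open>V\<close>. It is
  set to \<open>0\<close> off these subsets, so that identities that hold only there become equations
  between functions.
\<close>

definition slice_monomial :: "'a set \<Rightarrow> nat \<Rightarrow> 'a set \<Rightarrow> 'a set \<Rightarrow> real" where
  "slice_monomial V k T z = of_bool (z \<subseteq> V \<and> card z = k \<and> T \<subseteq> z)"

definition slice_monomials :: "'a set \<Rightarrow> nat \<Rightarrow> nat \<Rightarrow> ('a set \<Rightarrow> real) set" where
  "slice_monomials V k j = slice_monomial V k ` {T. T \<subseteq> V \<and> card T = j}"

lemma finite_slice_monomials: "finite V \<Longrightarrow> finite (slice_monomials V k j)"
  unfolding slice_monomials_def by simp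

lemma card_slice_monomials_le:
  "finite V \<Longrightarrow> card (slice_monomials V k j) \<le> card V choose j"
  unfolding slice_monomials_def
  using card_image_le[of "{T. T \<subseteq> V \<and> card T = j}" "slice_monomial V k"] n_subsets[of V j]
  by simp

lemma slice_monomial_in_span:
  "T \<subseteq> V \<Longrightarrow> card T = j \<Longrightarrow> slice_monomial V k T \<in> fun_vs.span (slice_monomials V k j)"
  unfolding slice_monomials_def by (intro fun_vs.span_base) auto

text \<open>
  A \<open>k\<close>-set \<open>z\<close> that contains \<open>T\<close> has \<open>k - card T\<close> elements outside \<open>T\<close>, which makes \<open>k - card T\<close>
  times the monomial of \<open>T\<close> equal to the sum of the monomials of all one-point extensions of \<open>T\<close>.
\<close>

lemma sum_slice_monomial_extensions:
  assumes "finite V" "T \<subseteq> V" "card T \<le> k"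
  shows "(\<Sum>i\<in>V - T. slice_monomial V k (insert i T) z)
         = real (k - card T) * slice_monomial V k T z"
proof (cases "z \<subseteq> V \<and> card z = k \<and> T \<subseteq> z")
  case True
  then have fin: "finite z" "finite T"
    using assms finite_subset by blast+
  have "(\<Sum>i\<in>V - T. slice_monomial V k (insert i T) z) = (\<Sum>i\<in>V - T. of_bool (i \<in> z))"
    using True by (intro sum.cong) (auto simp: slice_monomial_def)
  also have "\<dots> = real (card ((V - T) \<inter> z))"
    using assms(1) by (simp add: of_bool_def sum.If_cases Int_def)
  also have "(V - T) \<inter> z = z - T"
    using True by auto
  also have "card (z - T) = k - card T"
    using True fin by (simp add: card_Diff_subset)
  finally show ?thesis
    using True by (simp add: slice_monomial_def)
next
  case False
  then have "slice_monomial V k T z = 0" "\<And>i. slice_monomial V k (insert i T) z = 0"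
    by (auto simp: slice_monomial_def)
  then show ?thesis
    by simp
qed

text \<open>
  The bound \<open>j < k\<close> is what allows dividing by the number \<open>k - j\<close> of extensions.
\<close>

lemma slice_monomial_in_span_Suc:
  assumes "finite V" "T \<subseteq> V" "card T = j" "j < k"
  shows "slice_monomial V k T \<in> fun_vs.span (slice_monomials V k (Suc j))"
proof -
  have "slice_monomial V k T
      = (\<lambda>z. inverse (real (k - j)) * (\<Sum>i\<in>V - T. slice_monomial V k (insert i T)) z)"
    using sum_slice_monomial_extensions[of V T k] assms
    by (auto simp: sum_fun_apply field_simps)
  moreover have "\<dots> \<in> fun_vs.span (slice_monomials V k (Suc j))"
    using assms finite_subset[OF assms(2,1)]
    by (intro fun_vs.span_scale fun_vs.span_sum slice_monomial_in_span) auto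
  ultimately show ?thesis
    by simp
qed

text \<open>
  Multiplication by the affine function \<open>card (x \<inter> z) - l\<close> raises the degree by one. Expanding
  \<open>card (x \<inter> z)\<close> into coordinates turns a monomial into monomials of the next degree, apart from
  the coordinates that occur already; these and the constant \<open>l\<close> leave a monomial of the old
  degree, which is lifted by the previous lemma.
\<close>

lemma span_slice_monomials_mult:
  assumes V: "finite V" and x: "x \<subseteq> V" and j: "j < k"
    and f: "f \<in> fun_vs.span (slice_monomials V k j)"
  shows "(\<lambda>z. (real (card (x \<inter> z)) - l) * f z) \<in> fun_vs.span (slice_monomials V k (Suc j))"
    (is "?m f \<in> ?W")
  using f
proof (induction rule: fun_vs.span_induct_alt)
  case base
  have "?m 0 = 0"
    by (auto simp: zero_fun_def)
  then show ?case
    using fun_vs.span_zero by metis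
next
  case (step c g h)
  then obtain T where T: "T \<subseteq> V" "card T = j" and g: "g = slice_monomial V k T"
    unfolding slice_monomials_def by auto
  have finx: "finite x" and finT: "finite T"
    using V x T finite_subset by blast+
  have "?m g = (\<Sum>i\<in>x. slice_monomial V k (insert i T)) - (\<lambda>z. l * slice_monomial V k T z)"
  proof
    fix z
    have "real (card (x \<inter> z)) = (\<Sum>i\<in>x. of_bool (i \<in> z))"
      using finx by (simp add: of_bool_def sum.If_cases Int_def)
    then have "real (card (x \<inter> z)) * slice_monomial V k T z
        = (\<Sum>i\<in>x. of_bool (i \<in> z) * slice_monomial V k T z)"
      by (simp add: sum_distrib_right)
    also have "\<dots> = (\<Sum>i\<in>x. slice_monomial V k (insert i T) z)"
      by (intro sum.cong) (auto simp: slice_monomial_def)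
    finally show "?m g z
        = ((\<Sum>i\<in>x. slice_monomial V k (insert i T)) - (\<lambda>z. l * slice_monomial V k T z)) z"
      by (simp add: g sum_fun_apply left_diff_distrib)
  qed
  moreover have "slice_monomial V k (insert i T) \<in> ?W" if "i \<in> x" for i
  proof (cases "i \<in> T")
    case True
    then show ?thesis
      using slice_monomial_in_span_Suc[OF V T j] by (simp add: insert_absorb)
  next
    case False
    then show ?thesis
      using T x that finT by (intro slice_monomial_in_span) auto
  qed
  ultimately have g_W: "?m g \<in> ?W"
    using slice_monomial_in_span_Suc[OF V T j]
    by (auto intro!: fun_vs.span_diff fun_vs.span_sum fun_vs.span_scale)
  have "?m ((\<lambda>z. c * g z) + h) = (\<lambda>z. c * ?m g z) + ?m h"
    by (auto simp: algebra_simps)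
  then show ?case
    using fun_vs.span_add[OF fun_vs.span_scale[OF g_W, of c] step.IH] by simp
qed

section \<open>Uniform families with few intersection sizes\<close>

definition annihilator :: "'a set \<Rightarrow> nat \<Rightarrow> nat set \<Rightarrow> 'a set \<Rightarrow> 'a set \<Rightarrow> real" where
  "annihilator V k L x z
     = (\<Prod>l\<in>L. real (card (x \<inter> z)) - real l) * of_bool (z \<subseteq> V \<and> card z = k)"

lemma annihilator_in_span:
  assumes "finite V" "x \<subseteq> V" "finite L" "card L \<le> k"
  shows "annihilator V k L x \<in> fun_vs.span (slice_monomials V k (card L))"
  using assms(3,4)
proof (induction rule: finite_induct)
  case empty
  have "annihilator V k {} x = slice_monomial V k {}"
    by (auto simp: annihilator_def slice_monomial_def)
  then show ?case
    by (simp add: slice_monomial_in_span)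
next
  case (insert l L)
  have "annihilator V k (insert l L) x
      = (\<lambda>z. (real (card (x \<inter> z)) - real l) * annihilator V k L x z)"
    using insert.hyps by (auto simp: annihilator_def)
  then show ?case
    using span_slice_monomials_mult[OF assms(1,2), of "card L" k "annihilator V k L x" "real l"]
      insert by simp
qed

lemma annihilator_eq_0: "finite L \<Longrightarrow> card (x \<inter> z) \<in> L \<Longrightarrow> annihilator V k L x z = 0"
  by (auto simp: annihilator_def)

lemma annihilator_self_neq_0:
  "finite L \<Longrightarrow> x \<subseteq> V \<Longrightarrow> card x = k \<Longrightarrow> k \<notin> L \<Longrightarrow> annihilator V k L x x \<noteq> 0"
  by (auto simp: annihilator_def)

text \<open>
  Evaluating a linear relation at a member \<open>x\<close> isolates the coefficient of the function of \<open>x\<close>.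
\<close>

lemma diagonal_functions_independent:
  fixes f :: "'a \<Rightarrow> 'a \<Rightarrow> real"
  assumes fin: "finite F" and diag: "\<And>x. x \<in> F \<Longrightarrow> f x x \<noteq> 0"
    and off: "\<And>x y. x \<in> F \<Longrightarrow> y \<in> F \<Longrightarrow> x \<noteq> y \<Longrightarrow> f x y = 0"
  shows "inj_on f F" "fun_vs.independent (f ` F)"
proof -
  show inj: "inj_on f F"
    using diag off by (metis inj_onI)
  have "u (f x) = 0" if u: "(\<Sum>v\<in>f ` F. (\<lambda>z. u v * v z)) = 0" and x: "x \<in> F" for u x
  proof -
    have "0 = (\<Sum>y\<in>F. u (f y) * f y x)"
      using fun_cong[OF u, of x] inj by (simp add: sum.reindex sum_fun_apply)
    also have "\<dots> = (\<Sum>y\<in>F. if y = x then u (f x) * f x x else 0)"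
      using off x by (intro sum.cong) auto
    finally show ?thesis
      using fin x diag by simp
  qed
  then show "fun_vs.independent (f ` F)"
    using fin by (auto simp: fun_vs.dependent_finite)
qed

theorem ray_chaudhuri_wilson:
  fixes F :: "'a set set"
  assumes V: "finite V" and F: "\<And>x. x \<in> F \<Longrightarrow> x \<subseteq> V \<and> card x = k"
    and L: "finite L" "card L \<le> k" "k \<notin> L"
    and inter: "\<And>x y. x \<in> F \<Longrightarrow> y \<in> F \<Longrightarrow> x \<noteq> y \<Longrightarrow> card (x \<inter> y) \<in> L"
  shows "card F \<le> card V choose card L"
proof -
  let ?f = "annihilator V k L"
  have fin: "finite F"
    using V F by (meson Pow_iff finite_Pow_iff finite_subset subsetI)
  have diag: "?f x x \<noteq> 0" if "x \<in> F" for x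
    using F[OF that] L by (simp add: annihilator_self_neq_0)
  have off: "?f x y = 0" if "x \<in> F" "y \<in> F" "x \<noteq> y" for x y
    using inter[OF that] L(1) by (simp add: annihilator_eq_0)
  note inj = diagonal_functions_independent(1)[of F ?f, OF fin diag off]
    and indep = diagonal_functions_independent(2)[of F ?f, OF fin diag off]
  have "?f ` F \<subseteq> fun_vs.span (slice_monomials V k (card L))"
    using F V L by (auto intro!: annihilator_in_span)
  from fun_vs.independent_span_bound[OF finite_slice_monomials[OF V] indep this]
  have "card F \<le> card (slice_monomials V k (card L))"
    by (simp add: card_image[OF inj])
  also have "\<dots> \<le> card V choose card L"
    by (rule card_slice_monomials_le[OF V])
  finally show ?thesis .
qed

section \<open>Balanced codes with a reflection-invariant degree set\<close>

text \<open>
  Every pair of complementary balanced words has exactly one member avoiding the point \<open>2 * n\<close>.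
\<close>

definition avoid_last :: "nat \<Rightarrow> nat set \<Rightarrow> nat set" where
  "avoid_last n x = (if 2 * n \<in> x then {1..2 * n} - x else x)"

lemma const_weight_words_finite: "x \<in> const_weight_words n \<Longrightarrow> finite x"
  using finite_subset[of x "{1..2 * n}"] by (simp add: const_weight_words_def)

lemma const_weight_words_card: "x \<in> const_weight_words n \<Longrightarrow> card x = n"
  by (simp add: const_weight_words_def)

lemma card_Int_const_weight_le: "x \<in> const_weight_words n \<Longrightarrow> card (x \<inter> y) \<le> n"
  using card_mono[of x "x \<inter> y"] const_weight_words_finite const_weight_words_card by fastforce

lemma card_complement_Int:
  assumes "x \<in> const_weight_words n" "y \<in> const_weight_words n"
  shows "card (({1..2 * n} - x) \<inter> y) = n - card (x \<inter> y)"
proof -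
  have "({1..2 * n} - x) \<inter> y = y - x \<inter> y"
    using assms(2) by (auto simp: const_weight_words_def)
  then show ?thesis
    using const_weight_words_finite[OF assms(2)] const_weight_words_card[OF assms(2)]
    by (simp add: card_Diff_subset)
qed

lemma complement_const_weight:
  "x \<in> const_weight_words n \<Longrightarrow> {1..2 * n} - x \<in> const_weight_words n"
  using const_weight_words_finite[of x n] by (simp add: const_weight_words_def card_Diff_subset)

lemma avoid_last_subset:
  assumes "x \<in> const_weight_words n"
  shows "avoid_last n x \<subseteq> {1..2 * n - 1}" "card (avoid_last n x) = n"
proof -
  have w: "avoid_last n x \<in> const_weight_words n"
    using assms complement_const_weight by (simp add: avoid_last_def)
  then show "card (avoid_last n x) = n"
    by (simp add: const_weight_words_def)
  have *: "avoid_last n x \<subseteq> {1..2 * n}" "2 * n \<notin> avoid_last n x"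
    using w by (auto simp: const_weight_words_def avoid_last_def)
  show "avoid_last n x \<subseteq> {1..2 * n - 1}"
  proof
    fix i assume i: "i \<in> avoid_last n x"
    with * have "i \<in> {1..2 * n}" "i \<noteq> 2 * n"
      by blast+
    then show "i \<in> {1..2 * n - 1}"
      by auto
  qed
qed

lemma card_avoid_last_Int:
  assumes x: "x \<in> const_weight_words n" and y: "y \<in> const_weight_words n"
  shows "card (avoid_last n x \<inter> avoid_last n y) \<in> {card (x \<inter> y), n - card (x \<inter> y)}"
proof -
  show ?thesis
    using card_Int_const_weight_le[OF x, of y] card_complement_Int[OF x y] card_complement_Int[OF y x]
      card_complement_Int[OF x complement_const_weight[OF y]]
    by (simp add: avoid_last_def Int_commute)
qed

lemma degree_set_bounds:
  assumes "C \<subseteq> const_weight_words n" "a \<in> degree_set n C"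
  shows "0 < a" "a \<le> n"
proof -
  obtain x y where xy: "x \<in> C" "y \<in> C" "x \<noteq> y" and a: "a = n - card (x \<inter> y)"
    using assms(2) unfolding degree_set_def johnson_dist_def by blast
  have w: "x \<in> const_weight_words n" "y \<in> const_weight_words n"
    using xy assms(1) by blast+
  note fin = const_weight_words_finite[OF w(1)] const_weight_words_finite[OF w(2)]
    and card = const_weight_words_card[OF w(1)] const_weight_words_card[OF w(2)]
  have "card (x \<inter> y) < n"
  proof (rule ccontr)
    assume "\<not> card (x \<inter> y) < n"
    then have "x \<inter> y = x" "x \<inter> y = y"
      using card_seteq[of x "x \<inter> y"] card_seteq[of y "x \<inter> y"] fin card by auto
    with xy(3) show False
      by blast
  qed
  with a show "0 < a" "a \<le> n"
    by simp_all
qed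

theorem theorem1p2:
  fixes n s :: nat and C :: "nat set set"
  assumes "n > 0"
    and "C \<subseteq> const_weight_words n"
    and "s = card (degree_set n C)"
    and "\<And>a. a \<in> degree_set n C \<Longrightarrow> n - a \<in> degree_set n C"
  shows "card C \<le> (2 * n - 1) choose s"
proof -
  let ?S = "degree_set n C"
  note bounds = degree_set_bounds[OF assms(2)]
  have S: "?S \<subseteq> {1..n}"
    using bounds by (auto simp: Suc_le_eq)
  then have fin: "finite ?S" and le: "card ?S \<le> n"
    using finite_subset card_mono[OF _ S] by auto
  have n_notin: "n \<notin> ?S"
    using assms(4)[of n] bounds(1)[of 0] by auto
  have inter: "card (avoid_last n x \<inter> avoid_last n y) \<in> ?S"
    if "x \<in> C" "y \<in> C" "x \<noteq> y" for x y
  proof -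
    have w: "x \<in> const_weight_words n" "y \<in> const_weight_words n"
      using that assms(2) by auto
    have "n - card (x \<inter> y) \<in> ?S"
      using that unfolding degree_set_def johnson_dist_def by blast
    moreover from this have "n - (n - card (x \<inter> y)) \<in> ?S"
      by (rule assms(4))
    ultimately show ?thesis
      using card_avoid_last_Int[OF w] card_Int_const_weight_le[OF w(1), of y] by auto
  qed
  have inj: "inj_on (avoid_last n) C"
  proof (rule inj_onI, rule ccontr)
    fix x y
    assume xy: "x \<in> C" "y \<in> C" "avoid_last n x = avoid_last n y" "x \<noteq> y"
    then have "card (avoid_last n x) \<in> ?S"
      using inter[of x y] by simp
    then show False
      using xy assms(2) avoid_last_subset(2) n_notin by auto
  qed
  have "card (avoid_last n ` C) \<le> card {1..2 * n - 1} choose card ?S"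
  proof (rule ray_chaudhuri_wilson[OF _ _ fin le n_notin])
    show "x \<subseteq> {1..2 * n - 1} \<and> card x = n" if "x \<in> avoid_last n ` C" for x
      using that assms(2) avoid_last_subset by blast
    show "card (x \<inter> y) \<in> ?S"
      if "x \<in> avoid_last n ` C" "y \<in> avoid_last n ` C" "x \<noteq> y" for x y
      using that inter by blast
  qed simp
  then show ?thesis
    using inj assms(3) by (simp add: card_image)
qed

end
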